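(* Let $O$ be an octonion division algebra over a field $F$, let $n\ge1$, and let $B\in M_n(O)$ be an upper triangular or a lower triangular matrix. Then $$\sigma_R(B)=\bigcup_{d\in\mathrm{diag}(B)}[d],$$ where $[d]=\{qdq^{-1}: q\in O,\ q\ne0\}$ is the conjugacy class of $d$ in $O$; that is, the set of right eigenvalues of $B$ in $O$ is exactly the union of the conjugacy classes of the diagonal entries of $B$.
   Context: An octonion algebra over a field $F$ is an 8-dimensional unital composition algebra over $F$ (when $\mathrm{char}(F)\neq2$, this is the same as an algebra obtained from $F$ by three Cayley--Dickson doublings); it is an octonion division algebra if every nonzero element is invertible. Such algebras are alternative, so any two elements generate an associative subalgebra and $qdq^{-1}$ is unambiguous. For $B=(b_{ij})\in M_n(O)$, $\vec v=(v_1,\dots,v_n)^T\in O^n$ and $\lambda\in O$, the vector $B\vec v$ has $i$-th entry $\sum_j b_{ij}v_j$ and $\vec v\lambda$ has $i$-th entry $v_i\lambda$. An element $\lambda\in O$ is a right eigenvalue of $B$ if $B\vec v=\vec v\lambda$ for some nonzero $\vec v\in O^n$. $\sigma_R(B)$ denotes the set of right eigenvalues of $B$, and $\mathrm{diag}(B)$ denotes the set of diagonal entries $\{b_{11},\dots,b_{nn}\}$. *)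

theory Defs
  imports "Jordan_Normal_Form.Matrix"
begin

text \<open>
  The multiplication of an octonion algebra is not associative, so it cannot be the
  type-class multiplication of a ring: scalar multiplication, product and unit are explicit
  parameters, and only the additive group structure is taken from a type class.
\<close>

definition polar_form :: "('o::ab_group_add \<Rightarrow> 'f::field) \<Rightarrow> 'o \<Rightarrow> 'o \<Rightarrow> 'f" where
  "polar_form N x y = N (x + y) - N x - N y"

text \<open>
  The field is arbitrary, so a quadratic form is given by homogeneity and bilinearity of its
  polar form, and nondegeneracy refers to the polar form; this is the convention that is also
  correct in characteristic 2. The polar form is symmetric, so linearity in one argument
  suffices.
\<close>

definition quadratic_form :: "('f::field \<Rightarrow> 'o::ab_group_add \<Rightarrow> 'o) \<Rightarrow> ('o \<Rightarrow> 'f) \<Rightarrow> bool" where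
  "quadratic_form scale N \<longleftrightarrow>
     (\<forall>a x. N (scale a x) = a\<^sup>2 * N x) \<and>
     (\<forall>x. Vector_Spaces.linear scale (*) (polar_form N x))"

definition nondegenerate_form :: "('o::ab_group_add \<Rightarrow> 'f::field) \<Rightarrow> bool" where
  "nondegenerate_form N \<longleftrightarrow> (\<forall>x. (\<forall>y. polar_form N x y = 0) \<longrightarrow> x = 0)"

locale unital_composition_algebra = vector_space scale
  for scale :: "'f::field \<Rightarrow> 'o::ab_group_add \<Rightarrow> 'o" +
  fixes mul :: "'o \<Rightarrow> 'o \<Rightarrow> 'o"  (infixl "\<star>" 70)
    and unit :: 'o
  assumes linear_mult_left: "\<And>y. Vector_Spaces.linear scale scale (\<lambda>x. x \<star> y)"
    and linear_mult_right: "\<And>x. Vector_Spaces.linear scale scale (\<lambda>y. x \<star> y)"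
    and unit_mult: "\<And>x. unit \<star> x = x"
    and mult_unit: "\<And>x. x \<star> unit = x"
    and ex_norm_form: "\<exists>N. quadratic_form scale N \<and> nondegenerate_form N \<and>
                           (\<forall>x y. N (x \<star> y) = N x * N y)"

locale octonion_algebra = unital_composition_algebra +
  assumes dim_eq_8: "dim UNIV = 8"

definition is_inverse :: "('o \<Rightarrow> 'o \<Rightarrow> 'o) \<Rightarrow> 'o \<Rightarrow> 'o \<Rightarrow> 'o \<Rightarrow> bool" where
  "is_inverse mul unit x y \<longleftrightarrow> mul x y = unit \<and> mul y x = unit"

locale octonion_division_algebra = octonion_algebra +
  assumes ex_inverse: "\<And>x. x \<noteq> 0 \<Longrightarrow> \<exists>y. is_inverse mul unit x y"

text \<open>
  In a composition algebra inverses are unique, so the description below denotes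
  the inverse of every invertible element.
\<close>

definition inverse_of :: "('o \<Rightarrow> 'o \<Rightarrow> 'o) \<Rightarrow> 'o \<Rightarrow> 'o \<Rightarrow> 'o" where
  "inverse_of mul unit x = (THE y. is_inverse mul unit x y)"

definition conjugacy_class :: "('o::zero \<Rightarrow> 'o \<Rightarrow> 'o) \<Rightarrow> 'o \<Rightarrow> 'o \<Rightarrow> 'o set" where
  "conjugacy_class mul unit d = {mul (mul q d) (inverse_of mul unit q) | q. q \<noteq> 0}"

text \<open>
  The library products for matrices and vectors require an associative entry type,
  hence the versions for an explicit product.
\<close>

definition mat_vec_mult :: "('o::comm_monoid_add \<Rightarrow> 'o \<Rightarrow> 'o) \<Rightarrow> 'o mat \<Rightarrow> 'o vec \<Rightarrow> 'o vec" where
  "mat_vec_mult mul B v = vec (dim_row B) (\<lambda>i. \<Sum>j<dim_col B. mul (B $$ (i,j)) (v $ j))"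

definition vec_scale_right :: "('o \<Rightarrow> 'o \<Rightarrow> 'o) \<Rightarrow> 'o vec \<Rightarrow> 'o \<Rightarrow> 'o vec" where
  "vec_scale_right mul v l = map_vec (\<lambda>x. mul x l) v"

definition right_eigenvalue :: "('o::comm_monoid_add \<Rightarrow> 'o \<Rightarrow> 'o) \<Rightarrow> 'o mat \<Rightarrow> 'o \<Rightarrow> bool" where
  "right_eigenvalue mul B l \<longleftrightarrow>
     (\<exists>v \<in> carrier_vec (dim_col B). v \<noteq> 0\<^sub>v (dim_col B) \<and>
        mat_vec_mult mul B v = vec_scale_right mul v l)"

definition right_spectrum :: "('o::comm_monoid_add \<Rightarrow> 'o \<Rightarrow> 'o) \<Rightarrow> 'o mat \<Rightarrow> 'o set" where
  "right_spectrum mul B = {l. right_eigenvalue mul B l}"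

definition lower_triangular :: "'a::zero mat \<Rightarrow> bool" where
  "lower_triangular A \<longleftrightarrow> (\<forall>i < dim_row A. \<forall>j < dim_col A. i < j \<longrightarrow> A $$ (i,j) = 0)"

end

theory Submission
  imports Defs
begin

text \<open>
  In an octonion division algebra \<open>\<lambda>\<close> is conjugate to \<open>d\<close> iff \<open>d x = x \<lambda>\<close> for some \<open>x \<noteq> 0\<close>, thus iff the
  linear endomorphism \<open>x \<mapsto> x \<lambda> - d x\<close> is not injective. If \<open>B v = v \<lambda>\<close> with \<open>B\<close> upper triangular, the
  last nonzero entry \<open>v\<^sub>i\<close> satisfies \<open>b\<^sub>i\<^sub>i v\<^sub>i = v\<^sub>i \<lambda>\<close>. Conversely, let \<open>k\<close> be the first index with \<open>\<lambda>\<close>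
  conjugate to \<open>b\<^sub>k\<^sub>k\<close>: put zeros below a solution of \<open>b\<^sub>k\<^sub>k v\<^sub>k = v\<^sub>k \<lambda>\<close> and find the entries above it
  by back substitution, where for \<open>i < k\<close> the map \<open>x \<mapsto> x \<lambda> - b\<^sub>i\<^sub>i x\<close> is injective, hence onto by
  finite dimension.
\<close>

section \<open>Identities in unital composition algebras, in any characteristic\<close>

context unital_composition_algebra
begin

lemma mul_add_left: "(x + y) \<star> z = x \<star> z + y \<star> z"
  and mul_scale_left: "scale a x \<star> z = scale a (x \<star> z)"
  using linear_mult_left[of z] by (simp_all add: Vector_Spaces.linear_iff)

lemma mul_add_right: "z \<star> (x + y) = z \<star> x + z \<star> y"
  and mul_scale_right: "z \<star> scale a x = scale a (z \<star> x)"
  using linear_mult_right[of z] by (simp_all add: Vector_Spaces.linear_iff)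

lemma mul_zero_left [simp]: "0 \<star> z = 0"
  using mul_scale_left[of 0 0 z] by simp

lemma mul_zero_right [simp]: "z \<star> 0 = 0"
  using mul_scale_right[of z 0 0] by simp

lemma mul_diff_left: "(x - y) \<star> z = x \<star> z - y \<star> z"
  using mul_add_left[of "x - y" y z] by (simp add: algebra_simps)

lemma mul_diff_right: "z \<star> (x - y) = z \<star> x - z \<star> y"
  using mul_add_right[of z "x - y" y] by (simp add: algebra_simps)

text \<open>The locale only asserts that a multiplicative form exists; one is fixed here so that
  conjugates and inverses have formulas.\<close>

definition norm_form :: "'o \<Rightarrow> 'f" where
  "norm_form = (SOME N. quadratic_form scale N \<and> nondegenerate_form N \<and>
                  (\<forall>x y. N (x \<star> y) = N x * N y))"

abbreviation polar :: "'o \<Rightarrow> 'o \<Rightarrow> 'f" where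
  "polar \<equiv> polar_form norm_form"

lemma quadratic_norm_form: "quadratic_form scale norm_form"
  and nondegenerate_norm_form: "nondegenerate_form norm_form"
  and norm_form_mul: "norm_form (x \<star> y) = norm_form x * norm_form y"
  using someI_ex[OF ex_norm_form] unfolding norm_form_def by auto

lemma norm_form_add: "norm_form (x + y) = norm_form x + norm_form y + polar x y"
  by (simp add: polar_form_def)

lemma polar_commute: "polar x y = polar y x"
  by (simp add: polar_form_def add.commute)

lemma polar_add_right: "polar x (y + z) = polar x y + polar x z"
  and polar_scale_right: "polar x (scale a y) = a * polar x y"
  using quadratic_norm_form by (simp_all add: quadratic_form_def Vector_Spaces.linear_iff)

lemma polar_add_left: "polar (y + z) x = polar y x + polar z x"
  and polar_scale_left: "polar (scale a y) x = a * polar y x"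
  by (simp_all add: polar_commute[of _ x] polar_add_right polar_scale_right)

lemma polar_diff_right: "polar x (y - z) = polar x y - polar x z"
  using polar_add_right[of x "y - z" z] by simp

lemma polar_diff_left: "polar (y - z) x = polar y x - polar z x"
  by (simp add: polar_commute[of _ x] polar_diff_right)

lemma polar_eqI:
  assumes "\<And>z. polar x z = polar y z"
  shows "x = y"
proof -
  have "\<forall>z. polar (x - y) z = 0"
    using assms by (simp add: polar_diff_left)
  then show ?thesis
    using nondegenerate_norm_form by (auto simp: nondegenerate_form_def)
qed

lemma polar_mul_same_left: "polar (x \<star> y) (x \<star> z) = norm_form x * polar y z"
  by (simp add: polar_form_def norm_form_mul algebra_simps flip: mul_add_right)

lemma polar_mul_same_right: "polar (y \<star> x) (z \<star> x) = polar y z * norm_form x"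
  by (simp add: polar_form_def norm_form_mul algebra_simps flip: mul_add_left)

text \<open>Polarisation of \<open>polar_mul_same_left\<close> in the left factor: replace it by
  \<open>x + z\<close>, expand, and cancel the pure terms.\<close>

lemma polar_mul_exchange:
  "polar (x \<star> y) (z \<star> w) + polar (z \<star> y) (x \<star> w) = polar x z * polar y w"
proof -
  have "polar ((x + z) \<star> y) ((x + z) \<star> w) = norm_form (x + z) * polar y w"
    by (rule polar_mul_same_left)
  then show ?thesis
    by (simp add: mul_add_left polar_add_left polar_add_right norm_form_add
        polar_mul_same_left algebra_simps)
qed

text \<open>The standard involution, trace minus identity, with \<open>polar x unit\<close> as the
  trace. No division by 2 occurs.\<close>

definition conj :: "'o \<Rightarrow> 'o" where
  "conj x = scale (polar x unit) unit - x"

text \<open>Left multiplication by \<open>conj x\<close> is the adjoint of left multiplication by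
  \<open>x\<close>: this is the exchange identity with one factor set to
  \<open>unit\<close>.\<close>

lemma polar_mul_left: "polar (x \<star> y) z = polar y (conj x \<star> z)"
  using polar_mul_exchange[of x y unit z]
  by (simp add: conj_def unit_mult mul_diff_left mul_scale_left polar_diff_right
      polar_scale_right algebra_simps)

lemma polar_mul_right: "polar (x \<star> y) z = polar x (z \<star> conj y)"
  using polar_mul_exchange[of x y z unit] polar_commute[of "z \<star> y" x]
  by (simp add: conj_def mult_unit mul_diff_right mul_scale_right polar_diff_right
      polar_scale_right algebra_simps)

text \<open>Adjointness moves \<open>conj x\<close> to the other argument, where multiplicativity
  extracts the norm; nondegeneracy removes the test vector. This is the substitute for associativity
  in cancellations.\<close>

lemma conj_mul_mul: "conj x \<star> (x \<star> y) = scale (norm_form x) y"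
proof (rule polar_eqI)
  fix z
  have "polar (conj x \<star> (x \<star> y)) z = polar (x \<star> z) (x \<star> y)"
    by (simp add: polar_mul_left polar_commute[of _ z])
  then show "polar (conj x \<star> (x \<star> y)) z = polar (scale (norm_form x) y) z"
    by (simp add: polar_mul_same_left polar_scale_left polar_commute[of z])
qed

lemma mul_mul_conj: "(y \<star> x) \<star> conj x = scale (norm_form x) y"
proof (rule polar_eqI)
  fix z
  have "polar ((y \<star> x) \<star> conj x) z = polar (z \<star> x) (y \<star> x)"
    by (simp add: polar_mul_right polar_commute[of _ z])
  then show "polar ((y \<star> x) \<star> conj x) z = polar (scale (norm_form x) y) z"
    by (simp add: polar_mul_same_right polar_scale_left polar_commute[of z] mult.commute)
qed

lemma conj_mul: "conj x \<star> x = scale (norm_form x) unit"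
  using conj_mul_mul[of x unit] by (simp add: mult_unit)

lemma mul_conj: "x \<star> conj x = scale (norm_form x) unit"
  using mul_mul_conj[of unit x] by (simp add: unit_mult)

text \<open>As \<open>conj x\<close> is \<open>- x\<close> up to a multiple of \<open>unit\<close>,
  associativity of the triple \<open>conj x\<close>, \<open>x\<close>, \<open>y\<close> carries over
  to \<open>x\<close>, \<open>x\<close>, \<open>y\<close>.\<close>

lemma left_alternative: "x \<star> (x \<star> y) = (x \<star> x) \<star> y"
proof -
  have "conj x \<star> (x \<star> y) = (conj x \<star> x) \<star> y"
    by (simp add: conj_mul conj_mul_mul mul_scale_left unit_mult)
  then show ?thesis
    by (simp add: conj_def mul_diff_left mul_scale_left unit_mult)
qed

lemma right_alternative: "(y \<star> x) \<star> x = y \<star> (x \<star> x)"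
proof -
  have "(y \<star> x) \<star> conj x = y \<star> (x \<star> conj x)"
    by (simp add: mul_conj mul_mul_conj mul_scale_right mult_unit)
  then show ?thesis
    by (simp add: conj_def mul_diff_right mul_scale_right mult_unit)
qed

text \<open>Expand the left alternative law for \<open>x + y\<close> acting on \<open>x\<close>; the
  alternative laws cancel all but the two mixed terms.\<close>

lemma flexible: "(x \<star> y) \<star> x = x \<star> (y \<star> x)"
  using left_alternative[of "x + y" x] right_alternative[of y x] left_alternative[of x x]
    left_alternative[of y x]
  by (simp add: mul_add_left mul_add_right)

lemma flexible_conj: "(x \<star> y) \<star> conj x = x \<star> (y \<star> conj x)"
  by (simp add: conj_def mul_diff_right mul_scale_right mult_unit flexible)

lemma mul_conj_mul: "x \<star> (conj x \<star> y) = scale (norm_form x) y"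
proof -
  have "x \<star> (conj x \<star> y) = conj x \<star> (x \<star> y)"
    by (simp add: conj_def mul_diff_left mul_diff_right mul_scale_left mul_scale_right unit_mult)
  then show ?thesis
    by (simp add: conj_mul_mul)
qed

text \<open>A nonzero element excludes the zero algebra. By nondegeneracy the norm is then not
  identically zero, and a nonzero value can be cancelled.\<close>

lemma norm_form_unit:
  assumes "x \<noteq> (0 :: 'o)"
  shows "norm_form unit = 1"
proof -
  obtain y where "polar x y \<noteq> 0"
    using assms nondegenerate_norm_form by (auto simp: nondegenerate_form_def)
  then obtain w where "norm_form w \<noteq> 0"
    by (metis polar_form_def diff_zero)
  then show ?thesis
    using norm_form_mul[of unit w] by (simp add: unit_mult)
qed

end

section \<open>Inverses and conjugacy classes\<close>

context octonion_division_algebra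
begin

lemma norm_form_nonzero:
  assumes "x \<noteq> 0"
  shows "norm_form x \<noteq> 0"
proof -
  obtain y where "x \<star> y = unit"
    using ex_inverse[OF assms] by (auto simp: is_inverse_def)
  then have "norm_form x * norm_form y = 1"
    using norm_form_unit[OF assms] norm_form_mul[of x y] by simp
  then show ?thesis
    by auto
qed

abbreviation inv_of :: "'b \<Rightarrow> 'b" where
  "inv_of \<equiv> inverse_of mul unit"

text \<open>Multiplying \<open>x \<star> y = unit\<close> by \<open>conj x\<close> on the left
  determines \<open>y\<close>, without associativity.\<close>

lemma is_inverse_unique:
  assumes "x \<noteq> 0" and "is_inverse mul unit x y"
  shows "y = scale (inverse (norm_form x)) (conj x)"
proof -
  have "scale (norm_form x) y = conj x"
    using conj_mul_mul[of x y] assms(2) by (simp add: is_inverse_def mult_unit)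
  then have "scale (inverse (norm_form x)) (conj x)
      = scale (inverse (norm_form x)) (scale (norm_form x) y)"
    by simp
  then show ?thesis
    using norm_form_nonzero[OF assms(1)] by simp
qed

lemma inverse_of_eqI:
  assumes "x \<noteq> 0" and "is_inverse mul unit x y"
  shows "inv_of x = y"
  unfolding inverse_of_def
  using assms is_inverse_unique by (intro the_equality) metis+

lemma inverse_of_eq:
  assumes "x \<noteq> 0"
  shows "inv_of x = scale (inverse (norm_form x)) (conj x)"
  using ex_inverse[OF assms] inverse_of_eqI[OF assms] is_inverse_unique[OF assms] by metis

lemma inverse_of_mul_mul: "x \<noteq> 0 \<Longrightarrow> inv_of x \<star> (x \<star> y) = y"
  and mul_inverse_of_mul: "x \<noteq> 0 \<Longrightarrow> x \<star> (inv_of x \<star> y) = y"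
  and flexible_inverse_of: "x \<noteq> 0 \<Longrightarrow> (x \<star> y) \<star> inv_of x = x \<star> (y \<star> inv_of x)"
  using norm_form_nonzero[of x]
  by (simp_all add: inverse_of_eq mul_scale_left mul_scale_right conj_mul_mul mul_conj_mul
      flexible_conj)

lemma inverse_of_mul: "x \<noteq> 0 \<Longrightarrow> inv_of x \<star> x = unit"
  and mul_inverse_of: "x \<noteq> 0 \<Longrightarrow> x \<star> inv_of x = unit"
  using inverse_of_mul_mul[of x unit] mul_inverse_of_mul[of x unit] by (simp_all add: mult_unit)

lemma inverse_of_nonzero: "x \<noteq> 0 \<Longrightarrow> inv_of x \<noteq> 0"
  using mul_inverse_of_mul[of x x] by auto

lemma inverse_of_inverse_of: "x \<noteq> 0 \<Longrightarrow> inv_of (inv_of x) = x"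
  by (simp add: inverse_of_eqI inverse_of_nonzero is_inverse_def inverse_of_mul mul_inverse_of)

text \<open>Take \<open>x\<close> to be the inverse of \<open>q\<close>: flexibility regroups the
  conjugate and \<open>q\<close> cancels from the left. The resulting condition is linear in
  \<open>x\<close>.\<close>

lemma conjugacy_class_iff:
  "l \<in> conjugacy_class mul unit d \<longleftrightarrow> (\<exists>x. x \<noteq> 0 \<and> d \<star> x = x \<star> l)"
proof
  assume "l \<in> conjugacy_class mul unit d"
  then obtain q where "q \<noteq> 0" "l = (q \<star> d) \<star> inv_of q"
    by (auto simp: conjugacy_class_def)
  then have "inv_of q \<noteq> 0 \<and> d \<star> inv_of q = inv_of q \<star> l"
    by (simp add: flexible_inverse_of inverse_of_mul_mul inverse_of_nonzero)
  then show "\<exists>x. x \<noteq> 0 \<and> d \<star> x = x \<star> l" ..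
next
  assume "\<exists>x. x \<noteq> 0 \<and> d \<star> x = x \<star> l"
  then obtain x where x: "x \<noteq> 0" "d \<star> x = x \<star> l"
    by blast
  then have "l = (inv_of x \<star> d) \<star> inv_of (inv_of x)"
    using flexible_inverse_of[OF inverse_of_nonzero[OF x(1)], of d]
    by (simp add: inverse_of_inverse_of inverse_of_mul_mul)
  then show "l \<in> conjugacy_class mul unit d"
    using inverse_of_nonzero[OF x(1)] by (auto simp: conjugacy_class_def)
qed

section \<open>Solvability of linear equations and triangular systems\<close>

lemma obtain_finite_basis:
  obtains Bs where "finite_dimensional_vector_space scale Bs"
proof -
  obtain Bs where Bs: "Bs \<subseteq> UNIV" "independent Bs" "UNIV \<subseteq> span Bs" "card Bs = dim UNIV"
    using basis_exists[of UNIV] by metis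
  \<comment> \<open>Infinite sets have \<open>card\<close> 0, so cardinality 8 forces
    finiteness.\<close>
  then have "finite Bs"
    using dim_eq_8 by (intro card_ge_0_finite) simp
  with Bs have "finite_dimensional_vector_space scale Bs"
    by unfold_locales auto
  then show thesis
    by (rule that)
qed

text \<open>A nonzero kernel element of the linear map would make \<open>l\<close> conjugate to
  \<open>d\<close>.\<close>

lemma sylvester_solvable:
  assumes "l \<notin> conjugacy_class mul unit d"
  shows "\<exists>x. x \<star> l - d \<star> x = c"
proof -
  obtain Bs where "finite_dimensional_vector_space scale Bs"
    by (rule obtain_finite_basis)
  then interpret fd: finite_dimensional_vector_space_pair scale Bs scale Bs
    by (simp add: finite_dimensional_vector_space_pair_def)
  let ?f = "\<lambda>x. x \<star> l - d \<star> x"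
  have lin: "Vector_Spaces.linear scale scale ?f"
    by (simp add: Vector_Spaces.linear_iff vector_space_axioms mul_add_left mul_add_right
        mul_scale_left mul_scale_right scale_right_diff_distrib)
  have "inj ?f"
  proof (rule injI)
    fix x y
    assume "?f x = ?f y"
    then have "d \<star> (x - y) = (x - y) \<star> l"
      by (simp add: mul_diff_left mul_diff_right algebra_simps)
    then have "x - y = 0"
      using assms conjugacy_class_iff by blast
    then show "x = y"
      by simp
  qed
  then have "surj ?f"
    using fd.linear_injective_imp_surjective[OF lin] by blast
  then show ?thesis
    by (auto dest: surjD[of _ c])
qed

text \<open>
  The injective ranking \<open>r\<close> of the indices covers upper and lower triangular systems alike.
\<close>

lemma triangular_system_solvable:
  fixes A :: "'i \<Rightarrow> 'i \<Rightarrow> 'b" and r :: "'i \<Rightarrow> int"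
  assumes "finite I" and "inj_on r I"
    and "\<And>i j. i \<in> I \<Longrightarrow> j \<in> I \<Longrightarrow> r j < r i \<Longrightarrow> A i j = 0"
    and "\<And>i. i \<in> I \<Longrightarrow> l \<notin> conjugacy_class mul unit (A i i)"
  shows "\<exists>v. \<forall>i\<in>I. v i \<star> l - (\<Sum>j\<in>I. A i j \<star> v j) = c i"
  using assms
proof (induction I arbitrary: c rule: finite_ranking_induct[where f = r])
  case empty
  then show ?case
    by simp
next
  case (insert m I)
  show ?case
  \<comment> \<open>The ranking induction gives that \<open>m\<close> has maximal rank, but not that
    it is new.\<close>
  proof (cases "m \<in> I")
    case True
    with insert.IH[of c] insert.prems show ?thesis
      by (simp add: insert_absorb)
  next
    case False
    \<comment> \<open>By maximality of \<open>r m\<close>, row \<open>m\<close> involves only its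
      own unknown and can be solved first.\<close>
    have zero: "A m j = 0" if "j \<in> I" for j
    proof -
      have "r j \<noteq> r m"
        using inj_onD[OF insert.prems(1), of j m] that False by auto
      with insert.hyps(2)[OF that] insert.prems(2)[of m j] that show ?thesis
        by simp
    qed
    obtain y where y: "y \<star> l - A m m \<star> y = c m"
      using sylvester_solvable insert.prems(3)[of m] by blast
    \<comment> \<open>The known contribution of column \<open>m\<close> moves to the right-hand
      side, hence the induction over arbitrary \<open>c\<close>.\<close>
    obtain v where v: "\<forall>i\<in>I. v i \<star> l - (\<Sum>j\<in>I. A i j \<star> v j) = c i + A i m \<star> y"
      using insert.IH[of "\<lambda>i. c i + A i m \<star> y"] insert.prems by (auto simp: inj_on_insert)
    have "(v(m := y)) i \<star> l - (\<Sum>j\<in>insert m I. A i j \<star> (v(m := y)) j) = c i"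
      if i: "i \<in> insert m I" for i
    proof -
      have "(\<Sum>j\<in>I. A i j \<star> (v(m := y)) j) = (\<Sum>j\<in>I. A i j \<star> v j)"
        using False by (intro sum.cong) auto
      then have sum: "(\<Sum>j\<in>insert m I. A i j \<star> (v(m := y)) j)
          = A i m \<star> y + (\<Sum>j\<in>I. A i j \<star> v j)"
        using False insert.hyps(1) by simp
      show ?thesis
      proof (cases "i = m")
        case True
        then show ?thesis
          unfolding sum using y by (simp add: zero)
      next
        case False
        with i v have "v i \<star> l - (\<Sum>j\<in>I. A i j \<star> v j) = c i + A i m \<star> y"
          by blast
        then show ?thesis
          unfolding sum using False by (simp add: algebra_simps)
      qed
    qed
    then show ?thesis
      by blast
  qed
qed

section \<open>Right eigenvalues of triangular matrices\<close>

lemma right_eigenvalue_iff: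
  assumes "B \<in> carrier_mat n n"
  shows "right_eigenvalue mul B l \<longleftrightarrow>
    (\<exists>v. (\<exists>i<n. v i \<noteq> 0) \<and> (\<forall>i<n. (\<Sum>j<n. B $$ (i, j) \<star> v j) = v i \<star> l))"
proof
  assume "right_eigenvalue mul B l"
  then obtain v where v: "v \<in> carrier_vec n" "v \<noteq> 0\<^sub>v n"
    "mat_vec_mult mul B v = vec_scale_right mul v l"
    using assms by (auto simp: right_eigenvalue_def)
  have "\<exists>i<n. v $ i \<noteq> 0"
    using v(1,2) by (metis carrier_vecD eq_vecI index_zero_vec)
  moreover have "(\<Sum>j<n. B $$ (i, j) \<star> v $ j) = v $ i \<star> l" if "i < n" for i
    using arg_cong[OF v(3), of "\<lambda>w. w $ i"] v(1) assms that
    by (simp add: mat_vec_mult_def vec_scale_right_def)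
  ultimately show "\<exists>v. (\<exists>i<n. v i \<noteq> 0) \<and> (\<forall>i<n. (\<Sum>j<n. B $$ (i, j) \<star> v j) = v i \<star> l)"
    by (intro exI[of _ "\<lambda>i. v $ i"]) blast
next
  assume "\<exists>v. (\<exists>i<n. v i \<noteq> 0) \<and> (\<forall>i<n. (\<Sum>j<n. B $$ (i, j) \<star> v j) = v i \<star> l)"
  then obtain v k where v: "k < n" "v k \<noteq> 0" "\<forall>i<n. (\<Sum>j<n. B $$ (i, j) \<star> v j) = v i \<star> l"
    by blast
  have "vec n v \<noteq> 0\<^sub>v n"
    using v(1,2) by (metis index_vec index_zero_vec(1))
  moreover have "mat_vec_mult mul B (vec n v) = vec_scale_right mul (vec n v) l"
    using assms v(3) by (intro eq_vecI) (simp_all add: mat_vec_mult_def vec_scale_right_def)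
  ultimately show "right_eigenvalue mul B l"
    using assms unfolding right_eigenvalue_def by (intro bexI[of _ "vec n v"]) auto
qed

lemma right_eigenvalue_triangular_iff:
  fixes r :: "nat \<Rightarrow> int"
  assumes B: "B \<in> carrier_mat n n" and inj: "inj r"
    and tri: "\<And>i j. i < n \<Longrightarrow> j < n \<Longrightarrow> r j < r i \<Longrightarrow> B $$ (i, j) = 0"
  shows "right_eigenvalue mul B l \<longleftrightarrow> (\<exists>i<n. l \<in> conjugacy_class mul unit (B $$ (i, i)))"
proof
  assume "right_eigenvalue mul B l"
  then obtain v where v: "\<exists>i<n. v i \<noteq> 0" "\<forall>i<n. (\<Sum>j<n. B $$ (i, j) \<star> v j) = v i \<star> l"
    using right_eigenvalue_iff[OF B] by blast
  let ?S = "{i. i < n \<and> v i \<noteq> 0}"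
  have "Max (r ` ?S) \<in> r ` ?S"
    using v(1) by (intro Max_in) auto
  then obtain i where i: "i < n" "v i \<noteq> 0" "r i = Max (r ` ?S)"
    by auto
  have maximal: "r j \<le> r i" if "j < n" "v j \<noteq> 0" for j
    using that by (simp add: i(3))
  \<comment> \<open>Terms of higher rank vanish through \<open>v\<close>, those of lower rank
    through \<open>B\<close>.\<close>
  have "B $$ (i, j) \<star> v j = 0" if "j < n" "j \<noteq> i" for j
  proof (cases "v j = 0")
    case False
    then have "r j < r i"
      using maximal[OF that(1)] injD[OF inj, of j i] that(2) by fastforce
    then show ?thesis
      using tri i(1) that(1) by simp
  qed simp
  then have "(\<Sum>j<n. B $$ (i, j) \<star> v j) = (\<Sum>j\<in>{i}. B $$ (i, j) \<star> v j)"
    using i(1) by (intro sum.mono_neutral_right) auto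
  then have "B $$ (i, i) \<star> v i = v i \<star> l"
    using v(2) i(1) by simp
  then show "\<exists>i<n. l \<in> conjugacy_class mul unit (B $$ (i, i))"
    using i(1,2) conjugacy_class_iff by blast
next
  assume ex: "\<exists>i<n. l \<in> conjugacy_class mul unit (B $$ (i, i))"
  let ?S = "{i. i < n \<and> l \<in> conjugacy_class mul unit (B $$ (i, i))}"
  have "Min (r ` ?S) \<in> r ` ?S"
    using ex by (intro Min_in) auto
  then obtain k where k: "k < n" "l \<in> conjugacy_class mul unit (B $$ (k, k))"
    "r k = Min (r ` ?S)"
    by auto
  \<comment> \<open>Minimality makes all diagonal entries of rank below \<open>r k\<close>
    non-conjugate to \<open>l\<close>, as back substitution requires.\<close>
  have minimal: "r k \<le> r j" if "j < n" "l \<in> conjugacy_class mul unit (B $$ (j, j))" for j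
    using that by (simp add: k(3))
  obtain x where x: "x \<noteq> 0" "B $$ (k, k) \<star> x = x \<star> l"
    using k(2) conjugacy_class_iff by blast
  let ?I = "{i. i < n \<and> r i < r k}"
  \<comment> \<open>The right-hand side is what the entry \<open>x\<close> at position
    \<open>k\<close> contributes to row \<open>i\<close>.\<close>
  have "\<exists>v. \<forall>i\<in>?I. v i \<star> l - (\<Sum>j\<in>?I. B $$ (i, j) \<star> v j) = B $$ (i, k) \<star> x"
  proof (rule triangular_system_solvable[where r = r])
    show "inj_on r ?I"
      using inj by (rule inj_on_subset) simp
    show "l \<notin> conjugacy_class mul unit (B $$ (i, i))" if "i \<in> ?I" for i
      using minimal[of i] that by auto
  qed (simp_all add: tri)
  then obtain v where v: "\<And>i. i \<in> ?I \<Longrightarrow>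
      v i \<star> l - (\<Sum>j\<in>?I. B $$ (i, j) \<star> v j) = B $$ (i, k) \<star> x"
    by blast
  define w where "w i = (if i \<in> ?I then v i else if i = k then x else 0)" for i
  have sum: "(\<Sum>j<n. B $$ (i, j) \<star> w j) = B $$ (i, k) \<star> x + (\<Sum>j\<in>?I. B $$ (i, j) \<star> v j)" for i
  proof -
    have "(\<Sum>j<n. B $$ (i, j) \<star> w j) = (\<Sum>j\<in>insert k ?I. B $$ (i, j) \<star> w j)"
      using k(1) by (intro sum.mono_neutral_right) (auto simp: w_def)
    also have "\<dots> = B $$ (i, k) \<star> w k + (\<Sum>j\<in>?I. B $$ (i, j) \<star> w j)"
      by (subst sum.insert) auto
    also have "(\<Sum>j\<in>?I. B $$ (i, j) \<star> w j) = (\<Sum>j\<in>?I. B $$ (i, j) \<star> v j)"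
      by (intro sum.cong) (auto simp: w_def)
    finally show ?thesis
      by (simp add: w_def)
  qed
  have "(\<Sum>j<n. B $$ (i, j) \<star> w j) = w i \<star> l" if "i < n" for i
  proof (cases "i \<in> ?I")
    case True
    then have "B $$ (i, k) \<star> x + (\<Sum>j\<in>?I. B $$ (i, j) \<star> v j) = v i \<star> l"
      using v[OF True] by (simp add: algebra_simps)
    then show ?thesis
      unfolding sum using True by (simp add: w_def)
  next
    case False
    \<comment> \<open>Row \<open>i\<close> has rank at least \<open>r k\<close>, so its coefficients
      in the columns of \<open>?I\<close> vanish.\<close>
    then have zero: "(\<Sum>j\<in>?I. B $$ (i, j) \<star> v j) = 0"
      using tri that by (intro sum.neutral) auto
    show ?thesis
    proof (cases "i = k")
      case True
      then show ?thesis
        unfolding sum using zero x(2) by (simp add: w_def)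
    next
      case neq: False
      then have "r k < r i"
        using False that injD[OF inj, of i k] by fastforce
      then show ?thesis
        unfolding sum using zero False neq tri[OF that k(1)] by (simp add: w_def)
    qed
  qed
  moreover have "w k \<noteq> 0"
    using x(1) by (simp add: w_def)
  ultimately show "right_eigenvalue mul B l"
    using right_eigenvalue_iff[OF B] k(1) by blast
qed

end

theorem proposition6p2:
  fixes scale :: "'f::field \<Rightarrow> 'o::ab_group_add \<Rightarrow> 'o"
    and mul :: "'o \<Rightarrow> 'o \<Rightarrow> 'o" and unit :: 'o
    and n :: nat and B :: "'o mat"
  assumes "octonion_division_algebra scale mul unit"
    and "n \<ge> 1"
    and "B \<in> carrier_mat n n"
    and "upper_triangular B \<or> lower_triangular B"
  shows "right_spectrum mul B = (\<Union>d \<in> set (diag_mat B). conjugacy_class mul unit d)"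
proof -
  interpret octonion_division_algebra scale mul unit
    by (rule assms(1))
  have "right_eigenvalue mul B l \<longleftrightarrow> (\<exists>i<n. l \<in> conjugacy_class mul unit (B $$ (i, i)))" for l
    using assms(4)
  proof
    assume "upper_triangular B"
    then show ?thesis
      using assms(3) by (intro right_eigenvalue_triangular_iff[where r = int]) auto
  next
    assume "lower_triangular B"
    then show ?thesis
      using assms(3)
      \<comment> \<open>Negation reverses the index order, so entries above the diagonal are the
        ones required to vanish.\<close>
      by (intro right_eigenvalue_triangular_iff[where r = "\<lambda>i. - int i"])
        (auto simp: lower_triangular_def inj_on_def)
  qed
  then show ?thesis
    using assms(3) by (auto simp: right_spectrum_def diag_mat_def)
qed

end
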